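(* Let $n\ge 1$, let $\mathfrak{d}$ be a delta operator on $\mathbb{C}_n[t]$, and let $\eta=(S_k)_{0\le k\le n}$ be the associated binomial curve. Then the $\mathbb{C}$-linear map $v\mapsto (v\star\eta(t))_n=\sum_{k=0}^n\binom{n}{k}v_{n-k}S_k(t)$ is compatible with products and units, i.e. $(u\star v\star\eta)_n=(u\star\eta)_n\boxplus_n^{\mathfrak{d}}(v\star\eta)_n$ and $e_0\mapsto S_n$, the unit of $\boxplus_n^{\mathfrak{d}}$. In particular it induces a morphism from the group $(\mathbb{C}^{n+1},\star)^{\times}$ (identified with the group of Sheffer curves attached to $\eta$, endowed with binomial convolution) to the group $(\mathbb{C}_n[t],\boxplus_n^{\mathfrak{d}})^{\times}$.
   Context: $\mathbb{C}_n[t]$ is the space of complex polynomials of degree at most $n$. A delta operator on $\mathbb{C}_n[t]$ is a linear endomorphism $\mathfrak{d}$ commuting with all translations $P(t)\mapsto P(t+a)$, with $\mathfrak{d}(1)=0$ and $\mathfrak{d}(t)\neq 0$. Its binomial curve is $\eta=(S_k)_{0\le k\le n}$, the unique family with $\deg S_k=k$, $S_0=1$, and $\mathfrak{d}S_k=kS_{k-1}$, $S_k(0)=0$ for $1\le k\le n$. Binomial convolution of sequences indexed by $0,\dots,n$ is $(a\star b)_m=\sum_{k=0}^m\binom{m}{k}a_kb_{m-k}$, with unit $e_0=(1,0,\dots,0)$; $(\mathbb{C}^{n+1},\star)^\times$ consists of the $v$ with $v_0\neq0$. A Sheffer curve attached to $\eta$ is a family $(P_k)_{0\le k\le n}$ with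 $\deg P_k=k$ and $\mathfrak{d}P_k=kP_{k-1}$ for $k\geq 1$; these are exactly the $v\star\eta(t)$ with $v_0\ne0$, and they are identified with $(\mathbb{C}^{n+1},\star)^\times$ via $v\mapsto v\star\eta$. Umbral additive convolution on $\mathbb{C}_n[t]$ is $(A\boxplus_n^{\mathfrak{d}}B)(z)=\frac1{n!}\sum_{k=0}^n(\mathfrak{d}^kA)(0)\,(\mathfrak{d}^{n-k}B)(z)$; it is a commutative associative product with unit $S_n$. *)

theory Defs
  imports Complex_Main "HOL-Computational_Algebra.Polynomial" "HOL-Algebra.Group"
begin

definition polys_upto :: "nat \<Rightarrow> complex poly set" where
  "polys_upto n = {p. degree p \<le> n}"

definition translate :: "complex \<Rightarrow> complex poly \<Rightarrow> complex poly" where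
  "translate a p = pcompose p [:a, 1:]"

text \<open>
  An endomorphism of the space of polynomials of degree at most \<open>n\<close> is a function on all
  polynomials of which only the values on \<^term>\<open>polys_upto n\<close> matter.
\<close>

definition linear_endo_upto :: "nat \<Rightarrow> (complex poly \<Rightarrow> complex poly) \<Rightarrow> bool" where
  "linear_endo_upto n D \<longleftrightarrow>
     (\<forall>p\<in>polys_upto n. D p \<in> polys_upto n) \<and>
     (\<forall>p\<in>polys_upto n. \<forall>q\<in>polys_upto n. D (p + q) = D p + D q) \<and>
     (\<forall>c. \<forall>p\<in>polys_upto n. D (smult c p) = smult c (D p))"

definition delta_operator :: "nat \<Rightarrow> (complex poly \<Rightarrow> complex poly) \<Rightarrow> bool" where
  "delta_operator n D \<longleftrightarrow>
     linear_endo_upto n D \<and>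
     (\<forall>a. \<forall>p\<in>polys_upto n. D (translate a p) = translate a (D p)) \<and>
     D 1 = 0 \<and> D [:0, 1:] \<noteq> 0"

text \<open>
  A family indexed by \<open>0, \<dots>, n\<close> is encoded as a function on \<^typ>\<open>nat\<close> that vanishes beyond \<open>n\<close>,
  so that equality of functions is equality of families.
\<close>

definition seqs_upto :: "nat \<Rightarrow> (nat \<Rightarrow> 'a::zero) set" where
  "seqs_upto n = {a. \<forall>k>n. a k = 0}"

definition binomial_curve ::
    "nat \<Rightarrow> (complex poly \<Rightarrow> complex poly) \<Rightarrow> (nat \<Rightarrow> complex poly) \<Rightarrow> bool" where
  "binomial_curve n D S \<longleftrightarrow>
     S \<in> seqs_upto n \<and>
     (\<forall>k\<le>n. degree (S k) = k) \<and>
     S 0 = 1 \<and>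
     (\<forall>k\<in>{1..n}. D (S k) = smult (of_nat k) (S (k - 1)) \<and> poly (S k) 0 = 0)"

text \<open>
  The condition \<^prop>\<open>P k \<noteq> 0\<close> is needed because the zero polynomial has \<^const>\<open>degree\<close> \<open>0\<close> here.
\<close>

definition sheffer_curve ::
    "nat \<Rightarrow> (complex poly \<Rightarrow> complex poly) \<Rightarrow> (nat \<Rightarrow> complex poly) \<Rightarrow> bool" where
  "sheffer_curve n D P \<longleftrightarrow>
     P \<in> seqs_upto n \<and>
     (\<forall>k\<le>n. P k \<noteq> 0 \<and> degree (P k) = k) \<and>
     (\<forall>k\<in>{1..n}. D (P k) = smult (of_nat k) (P (k - 1)))"

definition binom_conv ::
    "nat \<Rightarrow> (nat \<Rightarrow> complex) \<Rightarrow> (nat \<Rightarrow> complex) \<Rightarrow> nat \<Rightarrow> complex" where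
  "binom_conv n a b m = (if m \<le> n then \<Sum>k=0..m. of_nat (m choose k) * a k * b (m - k) else 0)"

definition conv_unit :: "nat \<Rightarrow> complex" where
  "conv_unit k = (if k = 0 then 1 else 0)"

definition conv_monoid :: "nat \<Rightarrow> (nat \<Rightarrow> complex) monoid" where
  "conv_monoid n = \<lparr>carrier = seqs_upto n, mult = binom_conv n, one = conv_unit\<rparr>"

text \<open>The same convolution, of a scalar sequence with a family of polynomials.\<close>

definition conv_curve ::
    "nat \<Rightarrow> (nat \<Rightarrow> complex) \<Rightarrow> (nat \<Rightarrow> complex poly) \<Rightarrow> nat \<Rightarrow> complex poly" where
  "conv_curve n v F m =
     (if m \<le> n then \<Sum>k=0..m. smult (of_nat (m choose k) * v k) (F (m - k)) else 0)"

definition umbral_conv ::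
    "nat \<Rightarrow> (complex poly \<Rightarrow> complex poly) \<Rightarrow> complex poly \<Rightarrow> complex poly \<Rightarrow> complex poly" where
  "umbral_conv n D A B =
     smult (1 / fact n) (\<Sum>k=0..n. smult (poly ((D ^^ k) A) 0) ((D ^^ (n - k)) B))"

definition umbral_monoid ::
    "nat \<Rightarrow> (complex poly \<Rightarrow> complex poly) \<Rightarrow> (nat \<Rightarrow> complex poly) \<Rightarrow> complex poly monoid" where
  "umbral_monoid n D S = \<lparr>carrier = polys_upto n, mult = umbral_conv n D, one = S n\<rparr>"

text \<open>
  Binomial convolution of Sheffer curves is convolution of their coordinate sequences:
  the structure of the unit group of \<^term>\<open>conv_monoid n\<close> is transported along
  \<^term>\<open>\<lambda>v. conv_curve n v S\<close>.
\<close>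

definition curve_coords ::
    "nat \<Rightarrow> (nat \<Rightarrow> complex poly) \<Rightarrow> (nat \<Rightarrow> complex poly) \<Rightarrow> nat \<Rightarrow> complex" where
  "curve_coords n S = the_inv_into (Units (conv_monoid n)) (\<lambda>v. conv_curve n v S)"

definition sheffer_group ::
    "nat \<Rightarrow> (complex poly \<Rightarrow> complex poly) \<Rightarrow> (nat \<Rightarrow> complex poly) \<Rightarrow> (nat \<Rightarrow> complex poly) monoid"
  where
  "sheffer_group n D S =
     \<lparr>carrier = {P. sheffer_curve n D P},
      mult = (\<lambda>P Q. conv_curve n (binom_conv n (curve_coords n S P) (curve_coords n S Q)) S),
      one = S\<rparr>"

end

theory Submission
  imports Defs "HOL-Computational_Algebra.Formal_Power_Series"
begin

text \<open>
  The curve \<open>(v \<star> \<eta>)\<^sub>m\<close> satisfies \<open>D(v \<star> \<eta>)\<^sub>m = m (v \<star> \<eta>)\<^sub>m\<^sub>-\<^sub>1\<close> and takes the value \<open>v\<^sub>m\<close> at \<open>0\<close>.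
  Substituting the iterates of this into the definition of the umbral convolution turns it into
  \<open>\<Sum>k. (n choose k) u\<^sub>n\<^sub>-\<^sub>k (v \<star> \<eta>)\<^sub>k = (u \<star> (v \<star> \<eta>))\<^sub>n\<close>, and associativity of the
  binomial convolution gives multiplicativity. Since the \<open>S\<^sub>k\<close> span the polynomials, the monoid laws
  of the umbral convolution are transported from those of the binomial convolution.
\<close>

section \<open>Binomial convolution and its action on families of polynomials\<close>

lemma smult_sum_right: "smult c (\<Sum>i\<in>I. p i) = (\<Sum>i\<in>I. smult c (p i))"
  by (induction I rule: infinite_finite_induct) (simp_all add: smult_add_right)

text \<open>Both sides group the same sum over \<open>i + j + l = m\<close> with multinomial
  weights. Since the family \<open>F\<close> is arbitrary, this serves scalar associativity as well
  as multiplicativity of the map to polynomials.\<close>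

lemma conv_curve_assoc:
  "conv_curve n (binom_conv n u v) F = conv_curve n u (conv_curve n v F)"
proof
  fix m
  \<comment> \<open>The two binomials multiply to the multinomial coefficient
    \<open>(i + j + l)! / (i! j! l!)\<close>.\<close>
  define f where "f i j l = smult (of_nat (((i + j + l) choose i) * ((j + l) choose j)) * u i * v j) (F l)"
    for i j l
  show "conv_curve n (binom_conv n u v) F m = conv_curve n u (conv_curve n v F) m"
  proof (cases "m \<le> n")
    case True
    have f: "smult (of_nat (m choose j) * (of_nat (j choose i) * (u i * v (j - i)))) (F (m - j))
        = f i (j - i) (m - j)" if "i \<le> j" "j \<le> m" for i j
    proof -
      have "i + (j - i) + (m - j) = m" "j - i + (m - j) = m - i"
        using that by simp_all
      moreover have "of_nat ((m choose i) * ((m - i) choose (j - i)))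
          = (of_nat (m choose j) * of_nat (j choose i) :: complex)"
        using choose_mult[OF that] by (metis of_nat_mult)
      ultimately show ?thesis
        by (simp add: f_def mult.assoc)
    qed
    have "conv_curve n (binom_conv n u v) F m
        = (\<Sum>j=0..m. \<Sum>i=0..j.
            smult (of_nat (m choose j) * (of_nat (j choose i) * (u i * v (j - i)))) (F (m - j)))"
      using True
      by (auto simp: conv_curve_def binom_conv_def smult_sum mult.assoc sum_distrib_left
          intro!: sum.cong)
    also have "\<dots> = (\<Sum>j=0..m. \<Sum>i=0..j. f i (j - i) (m - j))"
      by (intro sum.cong refl f) auto
    \<comment> \<open>The outer index changes from the sum of the first two arguments of
      \<open>f\<close> to the first argument alone, as in the associativity of power series
      products.\<close>
    also have "\<dots> = (\<Sum>j=0..m. \<Sum>i=0..m - j. f j i (m - j - i))"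
      by (rule fps_mult_assoc_lemma)
    also have "\<dots> = conv_curve n u (conv_curve n v F) m"
      using True
      by (auto simp: conv_curve_def f_def smult_sum_right ac_simps intro!: sum.cong)
    finally show ?thesis .
  qed (simp add: conv_curve_def)
qed

text \<open>Viewing scalars as constant polynomials makes \<open>binom_conv\<close> an instance of
  \<open>conv_curve\<close>, so its associativity and unit law follow from those for
  families.\<close>

lemma conv_curve_const: "conv_curve n u (\<lambda>k. [:v k:]) = (\<lambda>m. [:binom_conv n u v m:])"
proof -
  have const_sum: "[:\<Sum>k\<in>A. g k:] = (\<Sum>k\<in>A. [:g k:])" for A and g :: "nat \<Rightarrow> complex"
    by (rule poly_eqI) (simp add: coeff_sum coeff_pCons split: nat.split)
  show ?thesis
    by (rule ext) (simp add: conv_curve_def binom_conv_def const_sum)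
qed

lemma binom_conv_assoc:
  "binom_conv n (binom_conv n u v) w = binom_conv n u (binom_conv n v w)"
  using conv_curve_assoc[of n u v "\<lambda>k. [:w k:]"] by (simp add: conv_curve_const fun_eq_iff)

lemma binom_conv_commute: "binom_conv n u v = binom_conv n v u"
proof
  fix m
  have "(\<Sum>k=0..m. of_nat (m choose k) * u k * v (m - k))
      = (\<Sum>k=0..m. of_nat (m choose k) * v k * u (m - k))"
    by (rule sum.reindex_bij_witness[of _ "\<lambda>k. m - k" "\<lambda>k. m - k"])
      (auto simp: binomial_symmetric[symmetric])
  then show "binom_conv n u v m = binom_conv n v u m"
    by (simp add: binom_conv_def)
qed

lemma binom_conv_in_seqs_upto: "binom_conv n u v \<in> seqs_upto n"
  by (simp add: binom_conv_def seqs_upto_def)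

lemma conv_curve_unit:
  assumes "F \<in> seqs_upto n"
  shows "conv_curve n conv_unit F = F"
proof
  fix m
  have "(\<Sum>k=0..m. smult (of_nat (m choose k) * conv_unit k) (F (m - k)))
      = (\<Sum>k=0..m. if k = 0 then F m else 0)"
    by (rule sum.cong) (auto simp: conv_unit_def)
  then show "conv_curve n conv_unit F m = F m"
    using assms by (simp add: conv_curve_def seqs_upto_def)
qed

lemma binom_conv_unit:
  assumes "v \<in> seqs_upto n"
  shows "binom_conv n conv_unit v = v"
proof -
  have "(\<lambda>k. [:v k:]) \<in> seqs_upto n"
    using assms by (simp add: seqs_upto_def)
  from conv_curve_unit[OF this] show ?thesis
    by (simp add: conv_curve_const fun_eq_iff)
qed

lemma conv_unit_in_seqs_upto: "conv_unit \<in> seqs_upto n"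
  by (simp add: conv_unit_def seqs_upto_def)

section \<open>The convolution monoid and its units\<close>

lemma comm_monoid_conv_monoid: "comm_monoid (conv_monoid n)"
  by (rule comm_monoidI)
    (simp_all add: conv_monoid_def binom_conv_in_seqs_upto binom_conv_assoc binom_conv_unit
      conv_unit_in_seqs_upto, simp add: binom_conv_commute)

text \<open>Passing to exponential generating functions turns binomial convolution into the product
  of power series, where a nonzero constant term suffices for an inverse.\<close>

lemma binom_conv_inverse:
  assumes "v 0 \<noteq> 0"
  obtains w where "w \<in> seqs_upto n" "binom_conv n v w = conv_unit"
proof
  define A where "A = Abs_fps (\<lambda>k. v k / fact k)"
  \<comment> \<open>Truncation puts \<open>w\<close> in \<open>seqs_upto n\<close>; it does not
    affect the product at any index \<open>m \<le> n\<close>, which only sees entries of index at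
    most \<open>m\<close>.\<close>
  define w where "w k = (if k \<le> n then fact k * fps_nth (inverse A) k else 0)" for k
  show "w \<in> seqs_upto n"
    by (simp add: w_def seqs_upto_def)
  have A0: "fps_nth A 0 \<noteq> 0"
    using assms by (simp add: A_def)
  show "binom_conv n v w = conv_unit"
  proof
    fix m
    show "binom_conv n v w m = conv_unit m"
    proof (cases "m \<le> n")
      case True
      have "binom_conv n v w m = (\<Sum>k=0..m. fact m * (fps_nth A k * fps_nth (inverse A) (m - k)))"
        using True by (auto simp: binom_conv_def w_def A_def binomial_fact intro!: sum.cong)
      also have "\<dots> = fact m * fps_nth (A * inverse A) m"
        by (simp add: fps_mult_nth sum_distrib_left)
      also have "A * inverse A = 1"
        using inverse_mult_eq_1[OF A0] by (simp add: mult.commute)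
      finally show ?thesis
        by (simp add: conv_unit_def)
    qed (auto simp: binom_conv_def conv_unit_def)
  qed
qed

lemma Units_conv_monoid: "Units (conv_monoid n) = {v \<in> seqs_upto n. v 0 \<noteq> 0}"
proof (intro equalityI subsetI)
  fix v assume "v \<in> Units (conv_monoid n)"
  then obtain w where v: "v \<in> seqs_upto n" and "binom_conv n w v = conv_unit"
    by (auto simp: Units_def conv_monoid_def)
  then have "binom_conv n w v 0 = 1"
    by (simp add: conv_unit_def)
  with v show "v \<in> {v \<in> seqs_upto n. v 0 \<noteq> 0}"
    by (auto simp: binom_conv_def)
next
  fix v :: "nat \<Rightarrow> complex" assume v: "v \<in> {v \<in> seqs_upto n. v 0 \<noteq> 0}"
  then obtain w where w: "w \<in> seqs_upto n" "binom_conv n v w = conv_unit"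
    using binom_conv_inverse[of v n] by blast
  with v show "v \<in> Units (conv_monoid n)"
    by (auto simp: Units_def conv_monoid_def binom_conv_commute[of n _ v])
qed

section \<open>Polynomials of bounded degree and the operator on them\<close>

lemma polys_upto_add: "p \<in> polys_upto n \<Longrightarrow> q \<in> polys_upto n \<Longrightarrow> p + q \<in> polys_upto n"
  by (simp add: polys_upto_def degree_add_le)

lemma polys_upto_smult: "p \<in> polys_upto n \<Longrightarrow> smult c p \<in> polys_upto n"
  using degree_smult_le order_trans by (fastforce simp: polys_upto_def)

lemma polys_upto_sum: "(\<And>i. i \<in> I \<Longrightarrow> p i \<in> polys_upto n) \<Longrightarrow> (\<Sum>i\<in>I. p i) \<in> polys_upto n"
  by (induction I rule: infinite_finite_induct) (auto simp: polys_upto_add, auto simp: polys_upto_def)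

locale umbral_basis =
  fixes n :: nat
    and D :: "complex poly \<Rightarrow> complex poly"
    and S :: "nat \<Rightarrow> complex poly"
  assumes linear: "linear_endo_upto n D"
    and D_one: "D 1 = 0"
    and curve: "binomial_curve n D S"
begin

lemma S_in_seqs: "S \<in> seqs_upto n"
  and degree_S: "k \<le> n \<Longrightarrow> degree (S k) = k"
  and S_0: "S 0 = 1"
  and D_S_pos: "1 \<le> k \<Longrightarrow> k \<le> n \<Longrightarrow> D (S k) = smult (of_nat k) (S (k - 1))"
  and poly_S_0: "1 \<le> k \<Longrightarrow> k \<le> n \<Longrightarrow> poly (S k) 0 = 0"
  using curve by (auto simp: binomial_curve_def)

lemma D_closed: "p \<in> polys_upto n \<Longrightarrow> D p \<in> polys_upto n"
  and D_add: "p \<in> polys_upto n \<Longrightarrow> q \<in> polys_upto n \<Longrightarrow> D (p + q) = D p + D q"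
  and D_smult: "p \<in> polys_upto n \<Longrightarrow> D (smult c p) = smult c (D p)"
  using linear by (auto simp: linear_endo_upto_def)

lemma D_0: "D 0 = 0"
  using D_smult[of 0 0] by (simp add: polys_upto_def)

lemma D_sum: "(\<And>i. i \<in> I \<Longrightarrow> p i \<in> polys_upto n) \<Longrightarrow> D (\<Sum>i\<in>I. p i) = (\<Sum>i\<in>I. D (p i))"
  by (induction I rule: infinite_finite_induct) (auto simp: D_0 D_add polys_upto_sum)

text \<open>At \<open>k = 0\<close> both sides vanish, by \<open>D 1 = 0\<close> and the factor
  \<open>of_nat 0\<close>, so the truncated subtraction \<open>0 - 1\<close> is harmless.\<close>

lemma D_S: "k \<le> n \<Longrightarrow> D (S k) = smult (of_nat k) (S (k - 1))"
  by (cases "k = 0") (simp_all add: S_0 D_one D_S_pos)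

lemma S_in_polys: "k \<le> n \<Longrightarrow> S k \<in> polys_upto n"
  by (simp add: polys_upto_def degree_S)

lemma S_nonzero: "k \<le> n \<Longrightarrow> S k \<noteq> 0"
  using degree_S[of k] by (cases "k = 0") (auto simp: S_0)

section \<open>The curves \<open>v \<star> \<eta>\<close> and their umbral products\<close>

abbreviation C :: "(nat \<Rightarrow> complex) \<Rightarrow> nat \<Rightarrow> complex poly" where
  "C v \<equiv> conv_curve n v S"

lemma C_in_seqs: "C v \<in> seqs_upto n"
  by (simp add: seqs_upto_def conv_curve_def)

lemma C_in_polys: "C v m \<in> polys_upto n"
proof (cases "m \<le> n")
  case True
  then show ?thesis
    by (auto simp: conv_curve_def intro!: polys_upto_sum polys_upto_smult S_in_polys)
qed (simp add: conv_curve_def polys_upto_def)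

text \<open>The absorption identity \<open>(m choose k) * (m - k) = m * ((m - 1) choose k)\<close>
  pulls the factor \<open>m\<close> out of every term, so the recurrence of \<open>S\<close> passes
  to \<open>C v\<close>.\<close>

lemma D_C:
  assumes "m \<le> n"
  shows "D (C v m) = smult (of_nat m) (C v (m - 1))"
proof (cases m)
  case 0
  then show ?thesis
    using D_smult[of 1 "v 0"] by (simp add: conv_curve_def S_0 polys_upto_def D_one)
next
  case (Suc l)
  have step: "smult (of_nat (m choose k) * v k) (D (S (m - k)))
      = smult (of_nat m) (smult (of_nat (l choose k) * v k) (S (l - k)))" if "k \<le> l" for k
  proof -
    have "(m choose k) * (m - k) = m * (l choose k)"
      using binomial_absorb_comp[of m k] Suc by (simp add: mult.commute)
    then have "of_nat (m choose k) * of_nat (m - k) = (of_nat m * of_nat (l choose k) :: complex)"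
      by (metis of_nat_mult)
    moreover have "D (S (m - k)) = smult (of_nat (m - k)) (S (l - k))"
      using D_S[of "m - k"] assms Suc by simp
    ultimately show ?thesis
      by (simp add: mult.assoc[symmetric]) (simp add: mult.commute mult.left_commute)
  qed
  have "D (C v m) = (\<Sum>k=0..m. smult (of_nat (m choose k) * v k) (D (S (m - k))))"
    using assms
    by (simp add: conv_curve_def D_sum D_smult S_in_polys polys_upto_smult)
  \<comment> \<open>The term \<open>k = m\<close> is a multiple of \<open>S 0 = 1\<close>, which
    \<open>D\<close> kills.\<close>
  also have "\<dots> = (\<Sum>k=0..l. smult (of_nat (m choose k) * v k) (D (S (m - k))))"
    by (simp add: Suc S_0 D_one)
  also have "\<dots> = (\<Sum>k=0..l. smult (of_nat m) (smult (of_nat (l choose k) * v k) (S (l - k))))"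
    by (rule sum.cong) (use step in auto)
  also have "\<dots> = smult (of_nat m) (C v (m - 1))"
    using assms Suc by (simp add: conv_curve_def smult_sum_right)
  finally show ?thesis .
qed

text \<open>Iterating the recurrence accumulates the falling factorial, written as a quotient so
  that it combines with the prefactor \<open>1 / fact n\<close> of
  \<open>umbral_conv\<close>.\<close>

lemma D_pow_C:
  assumes "j \<le> n"
  shows "(D ^^ j) (C v n) = smult (fact n / fact (n - j)) (C v (n - j))"
  using assms
proof (induction j)
  case (Suc j)
  have "n - j = Suc (n - Suc j)"
    using Suc.prems by simp
  then have "fact (n - j) = (of_nat (n - j) * fact (n - Suc j) :: complex)"
    by (metis fact_Suc)
  moreover have "(of_nat (n - j) :: complex) \<noteq> 0"
    using Suc.prems by simp
  ultimately have "fact n / fact (n - j) * of_nat (n - j) = (fact n / fact (n - Suc j) :: complex)"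
    by (simp del: of_nat_diff)
  with Suc show ?case
    by (simp add: D_smult C_in_polys D_C del: of_nat_diff)
qed simp

text \<open>Every \<open>S k\<close> with \<open>k > 0\<close> vanishes at 0, so only the constant
  term survives. Evaluation at 0 thus recovers \<open>v\<close> from its curve.\<close>

lemma poly_C_0:
  assumes "m \<le> n"
  shows "poly (C v m) 0 = v m"
proof -
  have "of_nat (m choose k) * v k * poly (S (m - k)) 0 = (if k = m then v m else 0)"
    if "k \<in> {0..m}" for k
    using that assms by (auto simp: S_0 poly_S_0)
  then have "poly (C v m) 0 = (\<Sum>k\<in>{0..m}. if k = m then v m else 0)"
    using assms unfolding conv_curve_def
    by (simp only: if_True poly_sum poly_smult cong: sum.cong)
  then show ?thesis
    by simp
qed

lemma umbral_conv_C: "umbral_conv n D (C u n) (C v n) = C (binom_conv n u v) n"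
proof -
  \<comment> \<open>The iterates of \<open>D\<close> contribute \<open>n! / (n - k)!\<close> and
    \<open>n! / k!\<close>; with the prefactor \<open>1 / n!\<close> they leave this binomial
    coefficient.\<close>
  have choose: "(fact n / (fact (n - k) * fact k) :: complex) = of_nat (n choose (n - k))"
    if "k \<le> n" for k
    using that by (simp add: binomial_fact mult.commute)
  have "umbral_conv n D (C u n) (C v n)
      = (\<Sum>k=0..n. smult (of_nat (n choose (n - k)) * u (n - k)) (C v (n - (n - k))))"
    unfolding umbral_conv_def
    by (auto simp: smult_sum_right D_pow_C poly_C_0 choose[symmetric] field_simps intro!: sum.cong)
  also have "\<dots> = (\<Sum>k=0..n. smult (of_nat (n choose k) * u k) (C v (n - k)))"
    by (rule sum.reindex_bij_witness[of _ "\<lambda>k. n - k" "\<lambda>k. n - k"]) auto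
  also have "\<dots> = C (binom_conv n u v) n"
    by (simp add: conv_curve_assoc conv_curve_def[of n u])
  finally show ?thesis .
qed

lemma C_unit: "C conv_unit = S"
  by (rule conv_curve_unit[OF S_in_seqs])

lemma C_add: "C (\<lambda>k. u k + v k) m = C u m + C v m"
  by (simp add: conv_curve_def sum.distrib[symmetric] algebra_simps smult_add_left)

lemma C_smult: "C (\<lambda>k. c * v k) m = smult c (C v m)"
  by (simp add: conv_curve_def smult_sum_right algebra_simps)

section \<open>The basis of the \<open>S k\<close> and the kernel of the operator\<close>

lemma C_n_reflected: "C v n = (\<Sum>k=0..n. smult (of_nat (n choose k) * v (n - k)) (S k))"
  unfolding conv_curve_def
  by (auto simp: binomial_symmetric[symmetric]
      intro!: sum.reindex_bij_witness[of _ "\<lambda>k. n - k" "\<lambda>k. n - k"])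

text \<open>Each degree up to \<open>n\<close> is attained by one \<open>S k\<close>, so leading
  terms can be eliminated successively.\<close>

lemma S_spans:
  assumes "degree p \<le> m" "m \<le> n"
  shows "\<exists>c. p = (\<Sum>k=0..m. smult (c k) (S k))"
  using assms
proof (induction m arbitrary: p)
  case 0
  then obtain a where "p = [:a:]"
    by (auto elim: degree_eq_zeroE)
  then show ?case
    by (intro exI[of _ "\<lambda>_. a"]) (simp add: S_0)
next
  case (Suc m)
  \<comment> \<open>This multiple of \<open>S (Suc m)\<close> cancels the coefficient of
    \<open>p\<close> in degree \<open>Suc m\<close>.\<close>
  define a where "a = coeff p (Suc m) / lead_coeff (S (Suc m))"
  define q where "q = p - smult a (S (Suc m))"
  have "degree q \<le> Suc m"
    using Suc.prems degree_S[of "Suc m"]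
    by (simp add: q_def degree_diff_le degree_smult_le)
  moreover have "coeff q (Suc m) = 0"
    using Suc.prems S_nonzero[of "Suc m"] degree_S[of "Suc m"]
    by (simp add: q_def a_def) (metis Zero_not_Suc degree_0 leading_coeff_0_iff)
  ultimately have "degree q \<le> m"
    by (metis Suc_leI degree_0 le_SucE leading_coeff_0_iff not_less_eq_eq zero_le)
  then obtain c where "q = (\<Sum>k=0..m. smult (c k) (S k))"
    using Suc by fastforce
  then have "p = (\<Sum>k=0..Suc m. smult ((c(Suc m := a)) k) (S k))"
    by (simp add: q_def algebra_simps)
  then show ?case
    by blast
qed

lemma C_surj:
  assumes "p \<in> polys_upto n"
  obtains v where "v \<in> seqs_upto n" "p = C v n"
proof -
  obtain c where c: "p = (\<Sum>k=0..n. smult (c k) (S k))"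
    using S_spans[of p n] assms by (auto simp: polys_upto_def)
  \<comment> \<open>By \<open>C_n_reflected\<close>, the coordinates of \<open>C v n\<close> are the
    entries of \<open>v\<close> in reverse order, scaled by nonzero binomials; this solves for
    \<open>v\<close>.\<close>
  define v where "v k = (if k \<le> n then c (n - k) / of_nat (n choose k) else 0)" for k
  have "p = C v n"
    unfolding C_n_reflected c
    by (auto simp: v_def binomial_symmetric[symmetric] intro!: sum.cong)
  then show thesis
    using that[of v] by (simp add: v_def seqs_upto_def)
qed

text \<open>Writing \<open>p = C v n\<close>, the value at 0 of the \<open>j\<close>-th iterate is a
  nonzero multiple of \<open>v (n - j)\<close>. All these values vanish: for \<open>j = 0\<close> by
  the value of \<open>p\<close> at 0, for \<open>j > 0\<close> by \<open>D p = 0\<close>.\<close>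

lemma ker_D:
  assumes p: "p \<in> polys_upto n" and "D p = 0" "poly p 0 = 0"
  shows "p = 0"
proof -
  obtain v where v: "p = C v n"
    using C_surj[OF p] by blast
  have pow: "(D ^^ j) p = 0" if "j > 0" for j
    using that \<open>D p = 0\<close> by (induction j) (auto simp: D_0, metis D_0 funpow_0 neq0_conv)
  have "v (n - j) = 0" if "j \<le> n" for j
  proof -
    have "poly ((D ^^ j) p) 0 = 0"
      using pow[of j] assms by (cases "j = 0") auto
    then show ?thesis
      using that D_pow_C[of j v] poly_C_0[of "n - j" v] v by auto
  qed
  then show ?thesis
    unfolding v C_n_reflected by simp
qed

section \<open>Sheffer curves and their coordinates\<close>

lemma sheffer_curve_C:
  assumes "v 0 \<noteq> 0"
  shows "sheffer_curve n D (C v)"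
proof -
  have "C v k \<noteq> 0 \<and> degree (C v k) = k" if k: "k \<le> n" for k
  proof -
    \<comment> \<open>Only the term \<open>i = 0\<close> reaches degree \<open>k\<close>, and its
      coefficient is \<open>v 0\<close>; the remainder \<open>r\<close> collects the terms of lower
      degree.\<close>
    define r where "r = (\<Sum>i=1..k. smult (of_nat (k choose i) * v i) (S (k - i)))"
    have C: "C v k = smult (v 0) (S k) + r"
      using k by (simp add: conv_curve_def r_def sum.atLeast_Suc_atMost)
    show ?thesis
    proof (cases "k = 0")
      \<comment> \<open>In degree 0 there is no strict degree gap, but \<open>r\<close> is an empty
        sum and \<open>C v 0\<close> is the nonzero constant \<open>v 0\<close>.\<close>
      case True
      then show ?thesis
        using C assms by (simp add: r_def S_0)
    next
      case False
      have "degree r < degree (smult (v 0) (S k))"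
        unfolding r_def using False k assms
        by (auto simp: degree_S intro!: degree_sum_less)
      then have "degree (C v k) = k"
        using C k assms by (simp add: degree_add_eq_left degree_S)
      with False show ?thesis
        by auto
    qed
  qed
  then show ?thesis
    by (auto simp: sheffer_curve_def C_in_seqs D_C)
qed

text \<open>By induction on the index, \<open>P\<close> and \<open>C v\<close> have the same image
  under \<open>D\<close>; their difference also vanishes at 0, so \<open>ker_D\<close>
  applies.\<close>

lemma sheffer_curve_imp_C:
  assumes P: "sheffer_curve n D P"
  obtains v where "v \<in> seqs_upto n" "v 0 \<noteq> 0" "P = C v"
proof
  \<comment> \<open>By \<open>poly_C_0\<close> the values at 0 are the only possible
    coordinates.\<close>
  define v where "v k = poly (P k) 0" for k
  have Pn: "P \<in> seqs_upto n"
    and deg: "\<And>k. k \<le> n \<Longrightarrow> P k \<noteq> 0 \<and> degree (P k) = k"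
    and DP: "\<And>k. 1 \<le> k \<Longrightarrow> k \<le> n \<Longrightarrow> D (P k) = smult (of_nat k) (P (k - 1))"
    using P by (auto simp: sheffer_curve_def)
  show "v \<in> seqs_upto n"
    using Pn by (simp add: v_def seqs_upto_def)
  obtain a where a: "P 0 = [:a:]" "a \<noteq> 0"
    using deg[of 0] by (auto elim: degree_eq_zeroE)
  then show "v 0 \<noteq> 0"
    by (simp add: v_def)
  have "P m = C v m" if "m \<le> n" for m
    using that
  proof (induction m)
    case 0
    then show ?case
      using a by (simp add: conv_curve_def v_def S_0)
  next
    case (Suc m)
    \<comment> \<open>The difference is formed as a sum with a multiple by \<open>-1\<close>, to
      match the laws \<open>D_add\<close> and \<open>D_smult\<close>.\<close>
    have PC: "P (Suc m) \<in> polys_upto n" "smult (-1) (C v (Suc m)) \<in> polys_upto n"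
      using Suc.prems deg[of "Suc m"] polys_upto_smult[OF C_in_polys]
      by (auto simp only: polys_upto_def mem_Collect_eq)
    have "P (Suc m) + smult (-1) (C v (Suc m)) = 0"
    proof (rule ker_D)
      show "D (P (Suc m) + smult (-1) (C v (Suc m))) = 0"
        unfolding D_add[OF PC] D_smult[OF C_in_polys]
        using Suc DP[of "Suc m"] D_C[of "Suc m" v] by (simp flip: smult_add_left)
      show "poly (P (Suc m) + smult (-1) (C v (Suc m))) 0 = 0"
        using Suc.prems poly_C_0[of "Suc m" v] by (simp add: v_def)
    qed (rule polys_upto_add[OF PC])
    then show ?case
      by simp
  qed
  moreover have "P m = C v m" if "\<not> m \<le> n" for m
    using that Pn by (simp add: seqs_upto_def conv_curve_def)
  ultimately show "P = C v"
    by blast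
qed

lemma inj_on_C: "inj_on C (seqs_upto n)"
proof (rule inj_onI)
  fix u v assume *: "u \<in> seqs_upto n" "v \<in> seqs_upto n" "C u = C v"
  show "u = v"
  proof
    show "u k = v k" for k
      using * poly_C_0[of k u] poly_C_0[of k v] by (cases "k \<le> n") (auto simp: seqs_upto_def)
  qed
qed

section \<open>The groups and the homomorphisms between them\<close>

lemma comm_monoid_umbral: "comm_monoid (umbral_monoid n D S)"
proof -
  have closed: "umbral_conv n D p q \<in> polys_upto n"
    if "p \<in> polys_upto n" "q \<in> polys_upto n" for p q
    using that by (metis C_surj umbral_conv_C C_in_polys)
  have assoc: "umbral_conv n D (umbral_conv n D p q) r = umbral_conv n D p (umbral_conv n D q r)"
    if pqr: "p \<in> polys_upto n" "q \<in> polys_upto n" "r \<in> polys_upto n" for p q r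
  proof -
    obtain u v w where "p = C u n" "q = C v n" "r = C w n"
      using pqr by (metis C_surj)
    then show ?thesis
      by (simp add: umbral_conv_C binom_conv_assoc)
  qed
  have commute: "umbral_conv n D p q = umbral_conv n D q p"
    if "p \<in> polys_upto n" "q \<in> polys_upto n" for p q
    using that by (metis C_surj umbral_conv_C binom_conv_commute)
  \<comment> \<open>Here \<open>S n\<close> is \<open>C conv_unit n\<close>, and
    \<open>C_surj\<close> supplies coordinates in \<open>seqs_upto n\<close>, on which
    \<open>conv_unit\<close> is neutral.\<close>
  have unit: "umbral_conv n D (S n) p = p" if "p \<in> polys_upto n" for p
    using that by (metis C_surj C_unit umbral_conv_C binom_conv_unit)
  show ?thesis
    by (rule comm_monoidI)
      (simp_all add: umbral_monoid_def closed assoc unit S_in_polys, rule commute)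
qed

lemma C_Units:
  assumes "v \<in> Units (conv_monoid n)"
  shows "C v n \<in> Units (umbral_monoid n D S)"
proof -
  obtain w where "binom_conv n w v = conv_unit" "binom_conv n v w = conv_unit"
    using assms by (auto simp: Units_def conv_monoid_def)
  then have "umbral_conv n D (C w n) (C v n) = S n" "umbral_conv n D (C v n) (C w n) = S n"
    by (simp_all add: umbral_conv_C C_unit)
  then show ?thesis
    using C_in_polys by (auto simp: Units_def umbral_monoid_def)
qed

lemma group_units_umbral: "group (units_of (umbral_monoid n D S))"
  using comm_monoid_umbral by (simp add: comm_monoid.axioms monoid.units_group)

lemma group_units_conv: "group (units_of (conv_monoid n))"
  using comm_monoid_conv_monoid by (simp add: comm_monoid.axioms monoid.units_group)

lemma group_hom_C_n:
  "group_hom (units_of (conv_monoid n)) (units_of (umbral_monoid n D S)) (\<lambda>v. C v n)"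
proof (intro group_hom.intro group_hom_axioms.intro group_units_conv group_units_umbral homI)
  show "C v n \<in> carrier (units_of (umbral_monoid n D S))"
    if "v \<in> carrier (units_of (conv_monoid n))" for v
    using that C_Units by (simp add: units_of_def)
qed (simp add: units_of_def conv_monoid_def umbral_monoid_def umbral_conv_C)

lemma curve_coords_C: "v \<in> Units (conv_monoid n) \<Longrightarrow> curve_coords n S (C v) = v"
  unfolding curve_coords_def
  by (rule the_inv_into_f_f[of C]) (auto intro: inj_on_subset[OF inj_on_C] simp: Units_conv_monoid)

lemma sheffer_curves_eq: "{P. sheffer_curve n D P} = C ` Units (conv_monoid n)"
  by (auto simp: Units_conv_monoid sheffer_curve_C elim: sheffer_curve_imp_C)

text \<open>The product of \<open>sheffer_group\<close> is defined by transport along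
  \<open>C\<close>, so compatibility only requires that \<open>curve_coords\<close> inverts
  \<open>C\<close> on units.\<close>

lemma C_iso: "C \<in> iso (units_of (conv_monoid n)) (sheffer_group n D S)"
proof (rule isoI)
  show "C \<in> hom (units_of (conv_monoid n)) (sheffer_group n D S)"
  proof (rule homI)
    show "C v \<in> carrier (sheffer_group n D S)" if "v \<in> carrier (units_of (conv_monoid n))" for v
      using that by (simp add: sheffer_group_def sheffer_curves_eq units_of_def)
  qed (simp add: units_of_def conv_monoid_def[of n] sheffer_group_def
      curve_coords_C[unfolded conv_monoid_def])
  show "bij_betw C (carrier (units_of (conv_monoid n))) (carrier (sheffer_group n D S))"
    by (auto simp: bij_betw_def sheffer_group_def sheffer_curves_eq units_of_def Units_conv_monoid
        intro: inj_on_subset[OF inj_on_C])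
qed

lemma group_sheffer: "group (sheffer_group n D S)"
proof -
  \<comment> \<open>Transport along an isomorphism gives a group whose unit is the image of the
    unit; that image is already \<open>S\<close>.\<close>
  have "sheffer_group n D S \<lparr>one := C \<one>\<^bsub>units_of (conv_monoid n)\<^esub>\<rparr> = sheffer_group n D S"
    by (simp add: sheffer_group_def units_of_def conv_monoid_def C_unit)
  then show ?thesis
    using group.iso_imp_img_group[OF group_units_conv C_iso] by simp
qed

lemma group_hom_last:
  "group_hom (sheffer_group n D S) (units_of (umbral_monoid n D S)) (\<lambda>P. P n)"
proof (intro group_hom.intro group_hom_axioms.intro group_sheffer group_units_umbral homI)
  have carrier: "carrier (sheffer_group n D S) = C ` Units (conv_monoid n)"
    by (simp add: sheffer_group_def sheffer_curves_eq)
  show "P n \<in> carrier (units_of (umbral_monoid n D S))" if "P \<in> carrier (sheffer_group n D S)" for P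
    using that C_Units by (auto simp: carrier units_of_def)
  \<comment> \<open>Since every Sheffer curve lies in the image of \<open>C\<close>, the coordinates
    reconstruct it, and the claim reduces to \<open>umbral_conv_C\<close>.\<close>
  have coords: "C (curve_coords n S P) = P" if "sheffer_curve n D P" for P
  proof -
    have "P \<in> C ` Units (conv_monoid n)"
      using that sheffer_curves_eq by blast
    then show ?thesis
      by (elim imageE) (simp add: curve_coords_C)
  qed
  show "(P \<otimes>\<^bsub>sheffer_group n D S\<^esub> Q) n = P n \<otimes>\<^bsub>units_of (umbral_monoid n D S)\<^esub> Q n"
    if "P \<in> carrier (sheffer_group n D S)" "Q \<in> carrier (sheffer_group n D S)" for P Q
    using that
    using umbral_conv_C[of "curve_coords n S P" "curve_coords n S Q"]
    by (simp add: sheffer_group_def units_of_def umbral_monoid_def coords)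
qed

end

theorem theorem1p3:
  fixes n :: nat
    and D :: "complex poly \<Rightarrow> complex poly"
    and S :: "nat \<Rightarrow> complex poly"
  assumes "n \<ge> 1"
    and "delta_operator n D"
    and "binomial_curve n D S"
  defines "\<Phi> \<equiv> (\<lambda>v. conv_curve n v S n)"
  shows
    "comm_monoid (conv_monoid n) \<and>
     Units (conv_monoid n) = {v \<in> seqs_upto n. v 0 \<noteq> 0} \<and>
     comm_monoid (umbral_monoid n D S) \<and>
     (\<forall>v\<in>seqs_upto n. \<Phi> v \<in> polys_upto n \<and>
        \<Phi> v = (\<Sum>k=0..n. smult (of_nat (n choose k) * v (n - k)) (S k))) \<and>
     (\<forall>u\<in>seqs_upto n. \<forall>v\<in>seqs_upto n. \<Phi> (\<lambda>k. u k + v k) = \<Phi> u + \<Phi> v) \<and>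
     (\<forall>c. \<forall>v\<in>seqs_upto n. \<Phi> (\<lambda>k. c * v k) = smult c (\<Phi> v)) \<and>
     (\<forall>u\<in>seqs_upto n. \<forall>v\<in>seqs_upto n.
        \<Phi> (binom_conv n u v) = umbral_conv n D (\<Phi> u) (\<Phi> v)) \<and>
     \<Phi> conv_unit = S n \<and>
     group_hom (units_of (conv_monoid n)) (units_of (umbral_monoid n D S)) \<Phi> \<and>
     (\<lambda>v. conv_curve n v S) \<in> iso (units_of (conv_monoid n)) (sheffer_group n D S) \<and>
     group_hom (sheffer_group n D S) (units_of (umbral_monoid n D S)) (\<lambda>P. P n)"
proof -
  interpret umbral_basis n D S
    using assms by unfold_locales (auto simp: delta_operator_def)
  show ?thesis
    unfolding \<Phi>_def
    by (intro conjI ballI allI comm_monoid_conv_monoid Units_conv_monoid comm_monoid_umbral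
        C_in_polys C_n_reflected C_add C_smult umbral_conv_C[symmetric] group_hom_C_n C_iso
        group_hom_last) (simp add: C_unit)
qed

end
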